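(* Let $p\ge1$, $n\ge 1$, and let $D_{A_1},\dots,D_{A_n}$ be the derivations of $T(F_a)$ associated with vector fields $A_1,\dots,A_n$ on $\mathbb C^p$. Let $\epsilon_F$ be the counit on $T(F_a)$. Then for all $\alpha,\beta\in\mathbb N^p$ $$\epsilon_F\big(D_{A_1}\circ D_{A_2}\circ\cdots\circ D_{A_n}(f_\beta^\alpha)\big)=\sum_{k_1\in\mathbb N^p}\cdots\sum_{k_{n-1}\in\mathbb N^p}\epsilon_F\big(D_{A_1}(f_{k_1}^\alpha)\big)\,\epsilon_F\big(D_{A_2}(f_{k_2}^{k_1})\big)\cdots\epsilon_F\big(D_{A_n}(f_\beta^{k_{n-1}})\big),$$ the sums being convergent, and $$\big|\epsilon_F\big(D_{A_1}\circ\cdots\circ D_{A_n}(f_\beta^\alpha)\big)\big|\le \frac{(\deg(\alpha)+n)!}{\deg(\alpha)!}\; m(A_1)\,m(A_2)\cdots m(A_n)\,\deg(\beta).$$ Moreover, if $\deg(\beta)>\deg(\alpha)+n+1$, then $\epsilon_F\big(D_{A_1}\circ\cdots\circ D_{A_n}(f_\beta^\alpha)\big)=0$.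
   Context: Work over $\mathbb C$. $F_a$ is the vector space with basis $f_n^m$, $n,m\in\mathbb N^p$ (an approximated coalgebra with formal coproduct $\Delta_F f_n^m=\sum_{k} f_k^m\otimes f_n^k$), with counit $\epsilon_F(f_n^m)=1$ if $n=m$ and $0$ otherwise. $T(F_a)$ is the tensor algebra of $F_a$, and $\epsilon_F$ is extended to $T(F_a)$ as a unital algebra morphism to $\mathbb C$. For $1\le i\le p$, $i(1)\in\mathbb N^p$ is the multi-index with $1$ in position $i$ and $0$ elsewhere. A vector field $A$ is given by components $A^i(z)=\sum_{m\in\mathbb N^p}a_m^i z_1^{m_1}\cdots z_p^{m_p}$, $1\le i\le p$, where the complex coefficients $a_m^i$ are zero except for finitely many $m$. The associated derivation $D_A$ is the unique derivation of the algebra $T(F_a)$ such that $$D_A(f_n^k)=\sum_{i=1}^p n_i\sum_{m\in\mathbb N^p}a_m^i f_{n+m-i(1)}^k\qquad(n,k\in\mathbb N^p),$$ terms with $n_i=0$ being read as $0$. Notation: $\deg(\alpha)=\sum_{i=1}^p\alpha_i$ for $\alpha\in\mathbb N^p$, and $m(A)=\sup_{1\le i\le p}\sum_{m\in\mathbb N^p}|a_m^i|$. *)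

theory Defs
  imports "HOL-Analysis.Analysis" "HOL-Library.Poly_Mapping"
begin

section \<open>Complex algebras, algebra morphisms, derivations\<close>

locale complex_algebra = vector_space scale
  for scale :: "complex \<Rightarrow> 'b::ring_1 \<Rightarrow> 'b" +
  assumes scale_mult_left: "scale c x * y = scale c (x * y)"
    and scale_mult_right: "x * scale c y = scale c (x * y)"

definition unital_algebra_hom ::
  "(complex \<Rightarrow> 'a::ring_1 \<Rightarrow> 'a) \<Rightarrow> (complex \<Rightarrow> 'b::ring_1 \<Rightarrow> 'b) \<Rightarrow> ('a \<Rightarrow> 'b) \<Rightarrow> bool" where
  "unital_algebra_hom s1 s2 h \<longleftrightarrow>
     Vector_Spaces.linear s1 s2 h \<and> h 1 = 1 \<and> (\<forall>x y. h (x * y) = h x * h y)"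

definition algebra_derivation ::
  "(complex \<Rightarrow> 'a::ring_1 \<Rightarrow> 'a) \<Rightarrow> ('a \<Rightarrow> 'a) \<Rightarrow> bool" where
  "algebra_derivation s D \<longleftrightarrow>
     Vector_Spaces.linear s s D \<and> (\<forall>x y. D (x * y) = D x * y + x * D y)"

section \<open>The tensor algebra of a vector space with a given basis\<close>

text \<open>
  The complex vector space with basis \<open>'x\<close> is \<open>'x \<Rightarrow>\<^sub>0 complex\<close>. Its r-th tensor power has as
  basis the words of length \<open>r\<close> in \<open>'x\<close> (the word \<open>x\<^sub>1 \<dots> x\<^sub>r\<close> standing for the elementary tensor
  of \<open>x\<^sub>1, \<dots>, x\<^sub>r\<close>), so that the tensor algebra has as basis all words, multiplied by
  concatenation. Wrapping words in a type with \<open>+\<close> as concatenation makes the (non-commutative)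
  convolution product of \<^theory>\<open>HOL-Library.Poly_Mapping\<close> the tensor product. The universal
  property is proved below as \<open>tensor_algebra_universal\<close>.
\<close>

datatype 'x tensor_word = Word (letters: "'x list")

instantiation tensor_word :: (type) monoid_add
begin
definition zero_tensor_word :: "'a tensor_word" where
  "0 = Word []"
definition plus_tensor_word :: "'a tensor_word \<Rightarrow> 'a tensor_word \<Rightarrow> 'a tensor_word" where
  "v + w = Word (letters v @ letters w)"
instance
  by standard (auto simp: zero_tensor_word_def plus_tensor_word_def)
end

type_synonym 'x tensor_algebra = "'x tensor_word \<Rightarrow>\<^sub>0 complex"

definition cscale :: "complex \<Rightarrow> ('a \<Rightarrow>\<^sub>0 complex) \<Rightarrow> ('a \<Rightarrow>\<^sub>0 complex)" where
  "cscale c p = Poly_Mapping.map ((*) c) p"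

definition tensor_incl :: "('x \<Rightarrow>\<^sub>0 complex) \<Rightarrow> 'x tensor_algebra" where
  "tensor_incl v =
     (\<Sum>x\<in>Poly_Mapping.keys v. Poly_Mapping.single (Word [x]) (Poly_Mapping.lookup v x))"

lemma lookup_cscale [simp]: "Poly_Mapping.lookup (cscale c p) x = c * Poly_Mapping.lookup p x"
  by (simp add: cscale_def map.rep_eq when_def)

lemma cscale_single [simp]: "cscale c (Poly_Mapping.single x d) = Poly_Mapping.single x (c * d)"
  by (simp add: cscale_def)

lemma vector_space_cscale: "vector_space cscale"
  by unfold_locales (auto intro!: poly_mapping_eqI simp: lookup_add algebra_simps)

lemma cscale_eq_mult: "cscale c p = Poly_Mapping.single 0 c * p"
  unfolding cscale_def by (rule mult_map_scale_conv_mult)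

lemma poly_mapping_sum_single:
  "p = (\<Sum>x\<in>Poly_Mapping.keys p. Poly_Mapping.single x (Poly_Mapping.lookup p x))"
  by (rule poly_mapping_eqI)
    (auto simp: lookup_sum lookup_single when_def in_keys_iff sum.delta)

lemma complex_algebra_cscale:
  "complex_algebra (cscale :: complex \<Rightarrow> 'x tensor_algebra \<Rightarrow> 'x tensor_algebra)"
proof -
  have comm: "p * Poly_Mapping.single 0 c = Poly_Mapping.single 0 c * p"
    for p :: "'x tensor_algebra" and c
  proof -
    have "p * Poly_Mapping.single 0 c =
        (\<Sum>x\<in>Poly_Mapping.keys p. Poly_Mapping.single x (Poly_Mapping.lookup p x)) * Poly_Mapping.single 0 c"
      by (subst poly_mapping_sum_single) simp
    also have "\<dots> = Poly_Mapping.single 0 c *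
        (\<Sum>x\<in>Poly_Mapping.keys p. Poly_Mapping.single x (Poly_Mapping.lookup p x))"
      by (simp add: sum_distrib_left sum_distrib_right mult_single mult.commute)
    also have "\<dots> = Poly_Mapping.single 0 c * p"
      by (subst (3) poly_mapping_sum_single) simp
    finally show ?thesis .
  qed
  show ?thesis
    unfolding complex_algebra_def complex_algebra_axioms_def
    using vector_space_cscale
    by (auto simp: cscale_eq_mult mult.assoc) (metis comm mult.assoc)
qed

lemma complex_algebra_complex: "complex_algebra ((*) :: complex \<Rightarrow> complex \<Rightarrow> complex)"
  by unfold_locales (auto simp: algebra_simps)

definition linear_ext ::
  "(complex \<Rightarrow> 'b::ab_group_add \<Rightarrow> 'b) \<Rightarrow> ('a \<Rightarrow> 'b) \<Rightarrow> ('a \<Rightarrow>\<^sub>0 complex) \<Rightarrow> 'b" where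
  "linear_ext s g p = (\<Sum>x\<in>Poly_Mapping.keys p. s (Poly_Mapping.lookup p x) (g x))"

context
  fixes s :: "complex \<Rightarrow> 'b::ab_group_add \<Rightarrow> 'b"
  assumes vs: "vector_space s"
begin

interpretation vector_space s by (fact vs)

lemma linear_ext_superset:
  assumes "finite S" "Poly_Mapping.keys p \<subseteq> S"
  shows "linear_ext s g p = (\<Sum>x\<in>S. s (Poly_Mapping.lookup p x) (g x))"
  unfolding linear_ext_def
  by (rule sum.mono_neutral_left) (use assms in \<open>auto simp: in_keys_iff\<close>)

lemma linear_linear_ext: "Vector_Spaces.linear cscale s (linear_ext s g)"
proof -
  have "linear_ext s g (p + q) = linear_ext s g p + linear_ext s g q" for p q
  proof -
    let ?S = "Poly_Mapping.keys p \<union> Poly_Mapping.keys q"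
    have "Poly_Mapping.keys (p + q) \<subseteq> ?S"
      by (rule keys_add)
    then show ?thesis
      by (subst (1 2 3) linear_ext_superset[of ?S])
        (auto simp: lookup_add scale_left_distrib sum.distrib)
  qed
  moreover have "linear_ext s g (cscale c p) = s c (linear_ext s g p)" for c p
  proof -
    have "Poly_Mapping.keys (cscale c p) \<subseteq> Poly_Mapping.keys p"
      by (auto simp: in_keys_iff)
    then show ?thesis
      by (subst (1 2) linear_ext_superset[of "Poly_Mapping.keys p"])
        (auto simp: scale_sum_right)
  qed
  ultimately show ?thesis
    unfolding Vector_Spaces.linear_def module_hom_def module_hom_axioms_def module_iff_vector_space
    using vs vector_space_cscale by auto
qed

lemma linear_ext_single [simp]: "linear_ext s g (Poly_Mapping.single x c) = s c (g x)"
  by (subst linear_ext_superset[of "{x}"]) auto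

lemma linear_eq_linear_ext:
  assumes "Vector_Spaces.linear cscale s h"
  shows "h = linear_ext s (\<lambda>x. h (Poly_Mapping.single x 1))"
proof
  fix p
  interpret h: Vector_Spaces.linear cscale s h by fact
  have "h p = h (\<Sum>x\<in>Poly_Mapping.keys p. cscale (Poly_Mapping.lookup p x) (Poly_Mapping.single x 1))"
    using poly_mapping_sum_single[of p] by simp
  also have "\<dots> = linear_ext s (\<lambda>x. h (Poly_Mapping.single x 1)) p"
    unfolding linear_ext_def h.sum h.scale ..
  finally show "h p = linear_ext s (\<lambda>x. h (Poly_Mapping.single x 1)) p" .
qed

lemma linear_eqI:
  assumes "Vector_Spaces.linear cscale s h" "Vector_Spaces.linear cscale s h'"
    and "\<And>x. h (Poly_Mapping.single x 1) = h' (Poly_Mapping.single x 1)"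
  shows "h = h'"
  using linear_eq_linear_ext[OF assms(1)] linear_eq_linear_ext[OF assms(2)] assms(3) by simp

end

lemma tensor_incl_single [simp]:
  "tensor_incl (Poly_Mapping.single x c) = Poly_Mapping.single (Word [x]) c"
  by (cases "c = 0") (auto simp: tensor_incl_def)

lemma linear_tensor_incl: "Vector_Spaces.linear cscale cscale tensor_incl"
proof -
  have "tensor_incl = linear_ext cscale (\<lambda>x. Poly_Mapping.single (Word [x]) 1)"
    by (auto simp: tensor_incl_def linear_ext_def)
  then show ?thesis
    using linear_linear_ext[OF vector_space_cscale] by metis
qed

lemma word_Nil: "Poly_Mapping.single (Word []) 1 = (1 :: 'x tensor_algebra)"
  by (metis single_one zero_tensor_word_def)

lemma word_append:
  "Poly_Mapping.single (Word (xs @ ys)) 1 =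
     (Poly_Mapping.single (Word xs) 1 * Poly_Mapping.single (Word ys) 1 :: 'x tensor_algebra)"
  by (simp add: mult_single plus_tensor_word_def)

lemma word_Cons:
  "Poly_Mapping.single (Word (x # xs)) 1 =
     (Poly_Mapping.single (Word [x]) 1 * Poly_Mapping.single (Word xs) 1 :: 'x tensor_algebra)"
  using word_append[of "[x]" xs] by simp

text \<open>An identity of two bilinear expressions on the tensor algebra holds if it holds on words.\<close>

lemma bilinear_words:
  fixes s :: "complex \<Rightarrow> 'b::ab_group_add \<Rightarrow> 'b" and B C :: "'x tensor_algebra \<Rightarrow> 'x tensor_algebra \<Rightarrow> 'b"
  assumes vs: "vector_space s"
    and B: "\<And>x. Vector_Spaces.linear cscale s (B x)" "\<And>y. Vector_Spaces.linear cscale s (\<lambda>x. B x y)"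
    and C: "\<And>x. Vector_Spaces.linear cscale s (C x)" "\<And>y. Vector_Spaces.linear cscale s (\<lambda>x. C x y)"
    and eq: "\<And>v w. B (Poly_Mapping.single (Word v) 1) (Poly_Mapping.single (Word w) 1) =
                   C (Poly_Mapping.single (Word v) 1) (Poly_Mapping.single (Word w) 1)"
  shows "B x y = C x y"
proof -
  have "B (Poly_Mapping.single v 1) = C (Poly_Mapping.single v 1)" for v
    by (rule linear_eqI[OF vs B(1) C(1)]) (metis eq tensor_word.collapse)
  then have "(\<lambda>x. B x y) = (\<lambda>x. C x y)"
    by (intro linear_eqI[OF vs B(2) C(2)]) simp
  then show ?thesis by (rule fun_cong)
qed

lemma linearI_cscale:
  assumes "vector_space s" "\<And>x y. f (x + y) = f x + f y" "\<And>c x. f (cscale c x) = s c (f x)"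
  shows "Vector_Spaces.linear cscale s f"
  unfolding Vector_Spaces.linear_def module_hom_def module_hom_axioms_def module_iff_vector_space
  using assms vector_space_cscale by auto

lemma linear_cscaleD:
  assumes "Vector_Spaces.linear cscale s f"
  shows "f (x + y) = f x + f y" "f (cscale c x) = s c (f x)"
proof -
  interpret Vector_Spaces.linear cscale s f by fact
  show "f (x + y) = f x + f y" "f (cscale c x) = s c (f x)" by (fact add scale)+
qed

lemmas tensor_scale_mult =
  complex_algebra.scale_mult_left[OF complex_algebra_cscale]
  complex_algebra.scale_mult_right[OF complex_algebra_cscale]

theorem tensor_algebra_universal:
  fixes s :: "complex \<Rightarrow> 'b::ring_1 \<Rightarrow> 'b" and \<phi> :: "('x \<Rightarrow>\<^sub>0 complex) \<Rightarrow> 'b"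
  assumes "complex_algebra s" and \<phi>: "Vector_Spaces.linear cscale s \<phi>"
  shows "\<exists>!h. unital_algebra_hom cscale s h \<and> (\<forall>v. h (tensor_incl v) = \<phi> v)"
proof (rule ex_ex1I)
  interpret complex_algebra s by fact
  have vs: "vector_space s" by unfold_locales
  let ?g = "\<lambda>w. prod_list (map (\<lambda>x. \<phi> (Poly_Mapping.single x 1)) (letters w))"
  let ?h = "linear_ext s ?g"
  have lin: "Vector_Spaces.linear cscale s ?h"
    by (rule linear_linear_ext[OF vs])
  note [simp] = linear_cscaleD[OF lin] linear_ext_single[OF vs]
  have "?h 1 = 1"
    using word_Nil[where 'x = 'x] by (metis linear_ext_single[OF vs] scale_one list.map(1)
      prod_list.Nil tensor_word.sel)
  moreover have "?h (x * y) = ?h x * ?h y" for x y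
    by (rule bilinear_words[OF vs, where B = "\<lambda>x y. ?h (x * y)" and C = "\<lambda>x y. ?h x * ?h y"])
      (auto intro!: linearI_cscale vs simp: algebra_simps tensor_scale_mult scale_mult_left
        scale_mult_right mult_single plus_tensor_word_def)
  moreover have "(\<lambda>v. ?h (tensor_incl v)) = \<phi>"
    by (rule linear_eqI[OF vs _ \<phi>])
      (auto intro!: linearI_cscale vs simp: linear_cscaleD[OF linear_tensor_incl])
  ultimately show "\<exists>h. unital_algebra_hom cscale s h \<and> (\<forall>v. h (tensor_incl v) = \<phi> v)"
    using lin unfolding unital_algebra_hom_def by (simp only: fun_eq_iff) blast
next
  interpret complex_algebra s by fact
  have vs: "vector_space s" by unfold_locales
  fix h h' :: "'x tensor_algebra \<Rightarrow> 'b"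
  assume h: "unital_algebra_hom cscale s h \<and> (\<forall>v. h (tensor_incl v) = \<phi> v)"
    and h': "unital_algebra_hom cscale s h' \<and> (\<forall>v. h' (tensor_incl v) = \<phi> v)"
  have gen: "h (Poly_Mapping.single (Word [x]) 1) = h' (Poly_Mapping.single (Word [x]) 1)" for x
    using h h' by (metis tensor_incl_single)
  have "h (Poly_Mapping.single (Word xs) 1) = h' (Poly_Mapping.single (Word xs) 1)" for xs
  proof (induction xs)
    case Nil
    then show ?case using h h' by (simp add: word_Nil unital_algebra_hom_def)
  next
    case (Cons x xs)
    then show ?case
      using h h' gen[of x] by (subst (1 2) word_Cons) (simp add: unital_algebra_hom_def)
  qed
  then show "h = h'"
    using h h' unfolding unital_algebra_hom_def
    by (intro linear_eqI[OF vs]) (auto, metis tensor_word.collapse)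
qed

primrec word_derivation :: "('x \<Rightarrow> 'x tensor_algebra) \<Rightarrow> 'x list \<Rightarrow> 'x tensor_algebra" where
  "word_derivation g [] = 0"
| "word_derivation g (x # xs) =
     g x * Poly_Mapping.single (Word xs) 1 + Poly_Mapping.single (Word [x]) 1 * word_derivation g xs"

lemma word_derivation_append:
  "word_derivation g (xs @ ys) =
     word_derivation g xs * Poly_Mapping.single (Word ys) 1
     + Poly_Mapping.single (Word xs) 1 * word_derivation g ys"
proof (induction xs)
  case Nil
  then show ?case by (simp add: word_Nil)
next
  case (Cons x xs)
  show ?case
    by (subst word_Cons[of x xs])
      (simp only: append_Cons word_derivation.simps Cons.IH word_append[of xs ys]
        distrib_left distrib_right mult.assoc add.assoc)
qed

text \<open>A derivation of the tensor algebra is determined by arbitrary values on the generators.\<close>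

theorem tensor_derivation_exists_unique:
  fixes g :: "'x \<Rightarrow> 'x tensor_algebra"
  shows "\<exists>!D. algebra_derivation cscale D \<and>
           (\<forall>x. D (tensor_incl (Poly_Mapping.single x 1)) = g x)"
proof (rule ex_ex1I)
  note vs = vector_space_cscale
  let ?D = "linear_ext cscale (\<lambda>w. word_derivation g (letters w))"
  have lin: "Vector_Spaces.linear cscale cscale ?D"
    by (rule linear_linear_ext[OF vs])
  note [simp] = linear_cscaleD[OF lin] linear_ext_single[OF vs] vector_space.vector_space_assms[OF vs]
  have "?D (x * y) = ?D x * y + x * ?D y" for x y
    by (rule bilinear_words[OF vs, where B = "\<lambda>x y. ?D (x * y)" and C = "\<lambda>x y. ?D x * y + x * ?D y"])
      (auto intro!: linearI_cscale vs simp: algebra_simps tensor_scale_mult mult_single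
        plus_tensor_word_def word_derivation_append)
  moreover have "?D (tensor_incl (Poly_Mapping.single x 1)) = g x" for x
    by (simp add: word_Nil)
  ultimately show "\<exists>D. algebra_derivation cscale D \<and>
           (\<forall>x. D (tensor_incl (Poly_Mapping.single x 1)) = g x)"
    using lin unfolding algebra_derivation_def by blast
next
  fix D D' :: "'x tensor_algebra \<Rightarrow> 'x tensor_algebra"
  assume D: "algebra_derivation cscale D \<and> (\<forall>x. D (tensor_incl (Poly_Mapping.single x 1)) = g x)"
    and D': "algebra_derivation cscale D' \<and> (\<forall>x. D' (tensor_incl (Poly_Mapping.single x 1)) = g x)"
  have gen: "D (Poly_Mapping.single (Word [x]) 1) = D' (Poly_Mapping.single (Word [x]) 1)" for x
    using D D' by (metis tensor_incl_single)
  have one: "E 1 = 0" if "algebra_derivation cscale E" for E :: "'x tensor_algebra \<Rightarrow> 'x tensor_algebra"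
    using that unfolding algebra_derivation_def
    by (metis add_cancel_left_right mult.right_neutral mult_1)
  have "D (Poly_Mapping.single (Word xs) 1) = D' (Poly_Mapping.single (Word xs) 1)" for xs
  proof (induction xs)
    case Nil
    then show ?case using D D' by (simp add: word_Nil one)
  next
    case (Cons x xs)
    then show ?case
      using D D' gen[of x] by (subst (1 2) word_Cons) (simp add: algebra_derivation_def)
  qed
  then show "D = D'"
    using D D' unfolding algebra_derivation_def
    by (intro linear_eqI[OF vector_space_cscale]) (auto, metis tensor_word.collapse)
qed

section \<open>The algebra \<open>T(F\<^sub>a)\<close>, its counit, and the derivation of a vector field\<close>

text \<open>
  Multi-indices are \<open>nat ^ 'p\<close>, with p the cardinality of \<open>'p\<close>; \<open>axis i 1\<close> is the multi-index i(1).
  The basis vector \<open>f\<^sub>n\<^sup>m\<close> of \<open>F\<^sub>a\<close> is indexed by \<open>(n, m)\<close>: lower index first.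
\<close>

type_synonym 'p Fa = "(nat ^ 'p) \<times> (nat ^ 'p) \<Rightarrow>\<^sub>0 complex"
type_synonym 'p TFa = "((nat ^ 'p) \<times> (nat ^ 'p)) tensor_algebra"

definition fgen :: "nat ^ 'p \<Rightarrow> nat ^ 'p \<Rightarrow> 'p::finite TFa" where
  "fgen n m = tensor_incl (Poly_Mapping.single (n, m) 1 :: 'p Fa)"

definition counit :: "'p::finite TFa \<Rightarrow> complex" where
  "counit = (THE e. unital_algebra_hom cscale (*) e \<and>
                    (\<forall>n m. e (fgen n m) = (if n = m then 1 else 0)))"

text \<open>
  A vector field with polynomial components: \<open>Poly_Mapping.lookup (A i) m\<close> is the coefficient of
  the monomial with exponent \<open>m\<close> in the i-th component.
\<close>

type_synonym 'p vector_field = "'p \<Rightarrow> (nat ^ 'p \<Rightarrow>\<^sub>0 complex)"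

text \<open>
  In \<open>n + m - axis i 1\<close> the subtraction on natural numbers is truncated, but only in terms whose
  coefficient \<open>n $ i\<close> is zero.
\<close>

definition derivation_of :: "'p::finite vector_field \<Rightarrow> 'p TFa \<Rightarrow> 'p TFa" where
  "derivation_of A = (THE D. algebra_derivation cscale D \<and>
     (\<forall>n k. D (fgen n k) =
        (\<Sum>i\<in>UNIV. cscale (of_nat (n $ i))
           (\<Sum>m\<in>Poly_Mapping.keys (A i).
              cscale (Poly_Mapping.lookup (A i) m) (fgen (n + m - axis i 1) k)))))"

definition mdeg :: "nat ^ 'p::finite \<Rightarrow> nat" where
  "mdeg \<alpha> = (\<Sum>i\<in>UNIV. \<alpha> $ i)"

definition vf_norm :: "'p::finite vector_field \<Rightarrow> real" where
  "vf_norm A = (SUP i. \<Sum>m\<in>Poly_Mapping.keys (A i). norm (Poly_Mapping.lookup (A i) m))"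

lemma counit_exists_unique:
  "\<exists>!e :: 'p::finite TFa \<Rightarrow> complex. unital_algebra_hom cscale (*) e \<and>
      (\<forall>n m. e (fgen n m) = (if n = m then 1 else 0))"
proof -
  have vs: "vector_space ((*) :: complex \<Rightarrow> complex \<Rightarrow> complex)"
    using complex_algebra_complex by (simp add: complex_algebra_def)
  let ?g = "\<lambda>(n :: nat ^ 'p, m). if n = m then 1 else 0 :: complex"
  let ?\<phi> = "linear_ext (*) ?g"
  have lin: "Vector_Spaces.linear cscale (*) ?\<phi>"
    by (rule linear_linear_ext[OF vs])
  have "(\<forall>v. e (tensor_incl v) = ?\<phi> v) \<longleftrightarrow> (\<forall>n m. e (fgen n m) = (if n = m then 1 else 0))"
    if "unital_algebra_hom cscale (*) e" for e :: "'p TFa \<Rightarrow> complex"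
  proof
    assume "\<forall>v. e (tensor_incl v) = ?\<phi> v"
    then show "\<forall>n m. e (fgen n m) = (if n = m then 1 else 0)"
      using linear_ext_single[OF vs, of ?g] by (simp add: fgen_def del: tensor_incl_single)
  next
    assume *: "\<forall>n m. e (fgen n m) = (if n = m then 1 else 0)"
    have "Vector_Spaces.linear cscale (*) (\<lambda>v. e (tensor_incl v))"
      using that unfolding unital_algebra_hom_def
      by (auto intro!: linearI_cscale vs
          simp: linear_cscaleD[OF linear_tensor_incl] dest: linear_cscaleD)
    then have "(\<lambda>v. e (tensor_incl v)) = ?\<phi>"
      using * by (intro linear_eqI[OF vs _ lin])
        (auto simp: fgen_def linear_ext_single[OF vs])
    then show "\<forall>v. e (tensor_incl v) = ?\<phi> v" by (blast dest: fun_cong)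
  qed
  then show ?thesis
    using tensor_algebra_universal[OF complex_algebra_complex lin]
    by (smt (verit))
qed

lemma derivation_of_exists_unique:
  fixes A :: "'p::finite vector_field"
  shows "\<exists>!D. algebra_derivation cscale D \<and>
     (\<forall>n k. D (fgen n k) =
        (\<Sum>i\<in>UNIV. cscale (of_nat (n $ i))
           (\<Sum>m\<in>Poly_Mapping.keys (A i).
              cscale (Poly_Mapping.lookup (A i) m) (fgen (n + m - axis i 1) k))))"
  using tensor_derivation_exists_unique[where
      g = "\<lambda>(n, k). \<Sum>i\<in>UNIV. cscale (of_nat (n $ i))
           (\<Sum>m\<in>Poly_Mapping.keys (A i).
              cscale (Poly_Mapping.lookup (A i) m) (fgen (n + m - axis i 1) k))"]
  by (simp add: fgen_def split_paired_all del: tensor_incl_single)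

definition comp_derivations :: "(nat \<Rightarrow> 'p::finite vector_field) \<Rightarrow> nat \<Rightarrow> 'p TFa \<Rightarrow> 'p TFa" where
  "comp_derivations A n = foldr (\<circ>) (map (\<lambda>j. derivation_of (A j)) [1..<Suc n]) id"

text \<open>
  \<open>has_iterated_sum r F s\<close>: in the iterated sum of \<open>F [k\<^sub>1, \<dots>, k\<^sub>r]\<close> over \<open>k\<^sub>1\<close> (outermost), \<dots>, \<open>k\<^sub>r\<close>
  (innermost), every sum converges (unconditionally), and the value is \<open>s\<close>.
\<close>

primrec has_iterated_sum :: "nat \<Rightarrow> ('a list \<Rightarrow> complex) \<Rightarrow> complex \<Rightarrow> bool" where
  "has_iterated_sum 0 F s \<longleftrightarrow> F [] = s"
| "has_iterated_sum (Suc r) F s \<longleftrightarrow>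
     (\<exists>g. (\<forall>k. has_iterated_sum r (\<lambda>ks. F (k # ks)) (g k)) \<and> (g has_sum s) UNIV)"

lemma has_iterated_sum_unique:
  "has_iterated_sum r F s \<Longrightarrow> has_iterated_sum r F t \<Longrightarrow> s = t"
proof (induction r arbitrary: F s t)
  case (Suc r)
  from Suc.prems obtain g h where
    "\<forall>k. has_iterated_sum r (\<lambda>ks. F (k # ks)) (g k)" "(g has_sum s) UNIV"
    "\<forall>k. has_iterated_sum r (\<lambda>ks. F (k # ks)) (h k)" "(h has_sum t) UNIV"
    by auto
  moreover from this have "g = h" using Suc.IH by blast
  ultimately show ?case by (metis has_sum_unique)
qed simp

end

theory Submission
  imports Defs
begin

text \<open>
  Fix the upper index \<open>\<alpha>\<close>. The derivation \<open>D\<^sub>A\<close> leaves it untouched and acts on the lower index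
  exactly as the first-order differential operator \<open>\<Sum>\<^sub>i A\<^sup>i \<partial>\<^sub>i\<close> acts on monomials, with \<open>f\<^sub>k\<^sup>\<alpha>\<close> in the
  role of \<open>z\<^sup>k\<close>; the counit reads off the coefficient of \<open>z\<^sup>\<alpha>\<close>. Hence
  \<open>\<epsilon>(D\<^sub>A\<^sub>1 \<circ> \<dots> \<circ> D\<^sub>A\<^sub>n (f\<^sub>\<beta>\<^sup>\<alpha>))\<close> is the coefficient of \<open>z\<^sup>\<alpha>\<close> in \<open>A\<^sub>1 (A\<^sub>2 (\<dots> (A\<^sub>n z\<^sup>\<beta>)))\<close>
  (\<open>counit_comp_derivations\<close>), and all three claims are about this polynomial.

  The iterated sum is the matrix product of the operators in the basis of monomials: expanding
  \<open>w = A\<^sub>2 (\<dots> (A\<^sub>n z\<^sup>\<beta>))\<close> in monomials and applying \<open>A\<^sub>1\<close> gives the outermost sum, which has only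
  finitely many nonzero terms because \<open>w\<close> is a polynomial
  (\<open>has_sum_lookup_vf_action\<close>, \<open>has_iterated_sum_paths\<close>).

  For the vanishing and the bound the operator applied first, \<open>A\<^sub>n\<close>, is peeled off instead. A vector
  field lowers the degree of a monomial by at most one, so \<open>z\<^sup>\<alpha>\<close> can be reached in \<open>n\<close> steps only
  from degree at most \<open>deg \<alpha> + n\<close> (\<open>lookup_vf_comp_eq_0\<close>). The coefficients of \<open>A z\<^sup>\<beta>\<close>
  have absolute sum at most \<open>deg \<beta> \<cdot> m(A)\<close>, because differentiating \<open>z\<^sup>\<beta>\<close> produces the factors
  \<open>\<beta>\<^sub>i\<close>, whose sum is \<open>deg \<beta>\<close>. The operator \<open>A\<^sub>j\<close> only matters on monomials of degree at most
  \<open>deg \<alpha> + j\<close>, so \<open>A\<^sub>1, \<dots>, A\<^sub>n\<^sub>-\<^sub>1\<close> contribute a quotient of factorials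
  (\<open>norm_lookup_vf_comp_le\<close>), while for \<open>A\<^sub>n\<close> the factor \<open>deg \<beta>\<close> is kept
  (\<open>norm_lookup_vf_comp_Suc_le\<close>).
\<close>

section \<open>Vector fields acting on polynomials\<close>

definition vf_monomial :: "'p::finite vector_field \<Rightarrow> nat ^ 'p \<Rightarrow> (nat ^ 'p \<Rightarrow>\<^sub>0 complex)" where
  "vf_monomial A n = (\<Sum>i\<in>UNIV. cscale (of_nat (n $ i))
     (\<Sum>m\<in>Poly_Mapping.keys (A i).
        Poly_Mapping.single (n + m - axis i 1) (Poly_Mapping.lookup (A i) m)))"

definition vf_action ::
  "'p::finite vector_field \<Rightarrow> (nat ^ 'p \<Rightarrow>\<^sub>0 complex) \<Rightarrow> (nat ^ 'p \<Rightarrow>\<^sub>0 complex)" where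
  "vf_action A = linear_ext cscale (vf_monomial A)"

definition vf_comp ::
  "(nat \<Rightarrow> 'p::finite vector_field) \<Rightarrow> nat \<Rightarrow> (nat ^ 'p \<Rightarrow>\<^sub>0 complex) \<Rightarrow> (nat ^ 'p \<Rightarrow>\<^sub>0 complex)" where
  "vf_comp A n = foldr (\<circ>) (map (\<lambda>j. vf_action (A j)) [1..<Suc n]) id"

lemma vf_comp_0 [simp]: "vf_comp A 0 v = v"
  by (simp add: vf_comp_def)

lemma foldr_comp: "foldr (\<circ>) fs g = foldr (\<circ>) fs id \<circ> g"
  by (induction fs) (auto simp: comp_assoc)

lemma vf_comp_Suc_inner: "vf_comp A (Suc n) v = vf_comp A n (vf_action (A (Suc n)) v)"
proof -
  have "vf_comp A (Suc n) = foldr (\<circ>) (map (\<lambda>j. vf_action (A j)) [1..<Suc n]) (vf_action (A (Suc n)))"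
    by (simp add: vf_comp_def)
  then show ?thesis
    using foldr_comp[of _ "vf_action (A (Suc n))"] by (metis comp_apply vf_comp_def)
qed

lemma vf_comp_Suc_outer: "vf_comp A (Suc n) v = vf_action (A 1) (vf_comp (\<lambda>j. A (Suc j)) n v)"
proof -
  have "[1..<Suc (Suc n)] = 1 # map Suc [1..<Suc n]"
    by (simp add: map_Suc_upt upt_conv_Cons del: upt_Suc)
  then show ?thesis
    by (simp add: vf_comp_def comp_def del: upt_Suc)
qed

lemma linear_vf_action: "Vector_Spaces.linear cscale cscale (vf_action A)"
  unfolding vf_action_def by (rule linear_linear_ext[OF vector_space_cscale])

lemma vf_action_single [simp]: "vf_action A (Poly_Mapping.single n c) = cscale c (vf_monomial A n)"
  unfolding vf_action_def by (rule linear_ext_single[OF vector_space_cscale])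

lemma linear_vf_comp: "Vector_Spaces.linear cscale cscale (vf_comp A n)"
proof (induction n)
  case 0
  show ?case by (auto intro!: linearI_cscale vector_space_cscale)
next
  case (Suc n)
  show ?case
    by (auto intro!: linearI_cscale vector_space_cscale
        simp: vf_comp_Suc_inner linear_cscaleD[OF linear_vf_action] linear_cscaleD[OF Suc.IH])
qed

section \<open>The counit as a coefficient\<close>

text \<open>
  With polynomials in the monomial basis, this embedding intertwines each vector field with its
  derivation (\<open>derivation_of_fcol\<close>), which transfers compositions to polynomials.
\<close>

definition fcol :: "nat ^ 'p \<Rightarrow> (nat ^ 'p \<Rightarrow>\<^sub>0 complex) \<Rightarrow> 'p::finite TFa" where
  "fcol \<alpha> = linear_ext cscale (\<lambda>k. fgen k \<alpha>)"

lemma linear_fcol: "Vector_Spaces.linear cscale cscale (fcol \<alpha>)"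
  unfolding fcol_def by (rule linear_linear_ext[OF vector_space_cscale])

lemma fcol_single [simp]: "fcol \<alpha> (Poly_Mapping.single n c) = cscale c (fgen n \<alpha>)"
  unfolding fcol_def by (rule linear_ext_single[OF vector_space_cscale])

lemma cscale_one [simp]: "cscale 1 v = v"
  by (rule vector_space.vector_space_assms(4)[OF vector_space_cscale])

lemma
  fixes n m :: "nat ^ 'p::finite"
  shows linear_counit: "Vector_Spaces.linear cscale (*) (counit :: 'p TFa \<Rightarrow> complex)"
    and counit_fgen: "counit (fgen n m) = (if n = m then 1 else 0)"
  using theI'[OF counit_exists_unique[where 'p = 'p], folded counit_def] by (auto simp: unital_algebra_hom_def)

lemma
  shows linear_derivation_of: "Vector_Spaces.linear cscale cscale (derivation_of A)"
    and derivation_of_fgen: "derivation_of A (fgen n k) =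
      (\<Sum>i\<in>UNIV. cscale (of_nat (n $ i))
         (\<Sum>m\<in>Poly_Mapping.keys (A i).
            cscale (Poly_Mapping.lookup (A i) m) (fgen (n + m - axis i 1) k)))"
  using theI'[OF derivation_of_exists_unique, of A, folded derivation_of_def]
  by (auto simp: algebra_derivation_def)

lemma counit_fcol: "counit (fcol \<alpha> v) = Poly_Mapping.lookup v \<alpha>"
proof -
  have vs: "vector_space ((*) :: complex \<Rightarrow> complex \<Rightarrow> complex)"
    using complex_algebra_complex by (simp add: complex_algebra_def)
  have "(\<lambda>v. counit (fcol \<alpha> v)) = (\<lambda>v. Poly_Mapping.lookup v \<alpha>)"
    by (rule linear_eqI[OF vs])
      (auto intro!: linearI_cscale vs simp: linear_cscaleD[OF linear_fcol]
        linear_cscaleD[OF linear_counit] counit_fgen lookup_add lookup_single)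
  then show ?thesis by (rule fun_cong)
qed

lemma derivation_of_fcol: "derivation_of A (fcol \<alpha> v) = fcol \<alpha> (vf_action A v)"
proof -
  interpret c: Vector_Spaces.linear cscale cscale "fcol \<alpha>" by (rule linear_fcol)
  have "derivation_of A (fgen k \<alpha>) = fcol \<alpha> (vf_monomial A k)" for k
    by (simp add: derivation_of_fgen vf_monomial_def c.sum c.scale)
  then have "(\<lambda>v. derivation_of A (fcol \<alpha> v)) = (\<lambda>v. fcol \<alpha> (vf_action A v))"
    by (intro linear_eqI[OF vector_space_cscale])
      (auto intro!: linearI_cscale vector_space_cscale simp: linear_cscaleD[OF linear_fcol]
        linear_cscaleD[OF linear_derivation_of] linear_cscaleD[OF linear_vf_action])
  then show ?thesis by (rule fun_cong)
qed

lemma fgen_eq_fcol: "fgen n \<alpha> = fcol \<alpha> (Poly_Mapping.single n 1)"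
  by simp

lemma counit_derivation_of:
  "counit (derivation_of A (fgen \<beta> \<alpha>)) = Poly_Mapping.lookup (vf_monomial A \<beta>) \<alpha>"
  unfolding fgen_eq_fcol derivation_of_fcol counit_fcol by simp

lemma counit_comp_derivations:
  "counit (comp_derivations A n (fgen \<beta> \<alpha>)) =
     Poly_Mapping.lookup (vf_comp A n (Poly_Mapping.single \<beta> 1)) \<alpha>"
proof -
  have "foldr (\<circ>) (map (\<lambda>j. derivation_of (A j)) js) id (fcol \<alpha> v) =
      fcol \<alpha> (foldr (\<circ>) (map (\<lambda>j. vf_action (A j)) js) id v)" for js v
    by (induction js) (auto simp: derivation_of_fcol)
  then show ?thesis
    unfolding fgen_eq_fcol comp_derivations_def vf_comp_def by (simp only: counit_fcol)
qed

section \<open>The sum over paths\<close>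

text \<open>The coefficients of a polynomial \<open>v\<close> have finite support, so linearity gives a convergent sum.\<close>

lemma has_sum_lookup_vf_action:
  "((\<lambda>k. Poly_Mapping.lookup (vf_monomial A k) \<alpha> * Poly_Mapping.lookup v k) has_sum
      Poly_Mapping.lookup (vf_action A v) \<alpha>) UNIV"
proof (rule has_sum_finite_neutralI)
  show "Poly_Mapping.lookup (vf_action A v) \<alpha> = (\<Sum>k\<in>Poly_Mapping.keys v.
      Poly_Mapping.lookup (vf_monomial A k) \<alpha> * Poly_Mapping.lookup v k)"
    by (simp add: vf_action_def linear_ext_def lookup_sum mult.commute)
qed (auto simp: in_keys_iff)

lemma has_iterated_sum_cmult:
  "has_iterated_sum r F s \<Longrightarrow> has_iterated_sum r (\<lambda>ks. c * F ks) (c * s)"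
proof (induction r arbitrary: F s)
  case (Suc r)
  then obtain g where g: "\<And>k. has_iterated_sum r (\<lambda>ks. F (k # ks)) (g k)" "(g has_sum s) UNIV"
    by auto
  then show ?case
    using Suc.IH by (auto intro!: exI[of _ "\<lambda>k. c * g k"] has_sum_cmult_right)
qed simp

lemma has_iterated_sum_paths:
  "has_iterated_sum r
     (\<lambda>ks. \<Prod>j=1..Suc r. Poly_Mapping.lookup
        (vf_monomial (A j) ((\<alpha> # ks @ [\<beta>]) ! j)) ((\<alpha> # ks @ [\<beta>]) ! (j - 1)))
     (Poly_Mapping.lookup (vf_comp A (Suc r) (Poly_Mapping.single \<beta> 1)) \<alpha>)"
proof (induction r arbitrary: A \<alpha>)
  case 0
  show ?case by (simp add: vf_comp_Suc_outer)
next
  case (Suc r)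
  let ?w = "vf_comp (\<lambda>j. A (Suc j)) (Suc r) (Poly_Mapping.single \<beta> 1)"
  let ?P = "\<lambda>k ks. \<Prod>j=1..Suc r. Poly_Mapping.lookup
        (vf_monomial (A (Suc j)) ((k # ks @ [\<beta>]) ! j)) ((k # ks @ [\<beta>]) ! (j - 1))"
  have split: "(\<Prod>j=1..Suc (Suc r). Poly_Mapping.lookup
        (vf_monomial (A j) ((\<alpha> # (k # ks) @ [\<beta>]) ! j)) ((\<alpha> # (k # ks) @ [\<beta>]) ! (j - 1)))
      = Poly_Mapping.lookup (vf_monomial (A 1) k) \<alpha> * ?P k ks" for k ks
  proof -
    have head: "(\<Prod>j=1..Suc (Suc r). h j) = h 1 * (\<Prod>j=1..Suc r. h (Suc j))" for h :: "nat \<Rightarrow> complex"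
      by (simp add: prod.atLeast_Suc_atMost prod.atLeast_Suc_atMost_Suc_shift del: prod.cl_ivl_Suc)
    show ?thesis
      by (subst head, intro arg_cong2[where f = "(*)"] prod.cong) (auto simp: nth_Cons')
  qed
  have "has_iterated_sum r
      (\<lambda>ks. Poly_Mapping.lookup (vf_monomial (A 1) k) \<alpha> * ?P k ks)
      (Poly_Mapping.lookup (vf_monomial (A 1) k) \<alpha> * Poly_Mapping.lookup ?w k)" for k
    by (intro has_iterated_sum_cmult Suc.IH)
  moreover have "((\<lambda>k. Poly_Mapping.lookup (vf_monomial (A 1) k) \<alpha> * Poly_Mapping.lookup ?w k) has_sum
      Poly_Mapping.lookup (vf_comp A (Suc (Suc r)) (Poly_Mapping.single \<beta> 1)) \<alpha>) UNIV"
    unfolding vf_comp_Suc_outer[of A "Suc r"] by (rule has_sum_lookup_vf_action)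
  ultimately show ?case
    unfolding has_iterated_sum.simps(2) split
    by (intro exI[of _ "\<lambda>k. Poly_Mapping.lookup (vf_monomial (A 1) k) \<alpha> * Poly_Mapping.lookup ?w k"]) blast
qed

section \<open>Degrees and the bound\<close>

text \<open>
  Peeling off the operator applied first gives a recursion in which \<open>\<alpha>\<close> stays fixed, as the degree
  estimates need.
\<close>

lemma lookup_vf_comp_Suc:
  "Poly_Mapping.lookup (vf_comp A (Suc n) (Poly_Mapping.single \<beta> 1)) \<alpha> =
     (\<Sum>i\<in>UNIV. of_nat (\<beta> $ i) * (\<Sum>m\<in>Poly_Mapping.keys (A (Suc n) i).
        Poly_Mapping.lookup (A (Suc n) i) m *
        Poly_Mapping.lookup (vf_comp A n (Poly_Mapping.single (\<beta> + m - axis i 1) 1)) \<alpha>))"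
proof -
  interpret c: Vector_Spaces.linear cscale cscale "vf_comp A n" by (rule linear_vf_comp)
  have single: "vf_comp A n (Poly_Mapping.single k c) =
      cscale c (vf_comp A n (Poly_Mapping.single k 1))" for k c
    using c.scale[of c "Poly_Mapping.single k 1"] by simp
  show ?thesis
    by (simp add: vf_comp_Suc_inner vf_monomial_def c.sum c.scale lookup_sum
        single[of _ "Poly_Mapping.lookup _ _"])
qed

text \<open>The hypothesis \<open>n\<^sub>i \<noteq> 0\<close> makes the truncated subtraction exact.\<close>

lemma mdeg_shift_ge:
  assumes "n $ i \<noteq> 0"
  shows "mdeg n \<le> Suc (mdeg (n + m - axis i 1))"
proof -
  have "mdeg n \<le> (\<Sum>j\<in>UNIV. (n + m - axis i 1) $ j + axis i 1 $ j)"
    unfolding mdeg_def using assms by (intro sum_mono) (auto simp: axis_def)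
  also have "\<dots> = Suc (mdeg (n + m - axis i 1))"
    by (simp only: sum.distrib) (simp add: mdeg_def axis_def)
  finally show ?thesis .
qed

lemma lookup_vf_comp_eq_0:
  "mdeg \<beta> > mdeg \<alpha> + n \<Longrightarrow>
     Poly_Mapping.lookup (vf_comp A n (Poly_Mapping.single \<beta> 1)) \<alpha> = 0"
proof (induction n arbitrary: \<beta>)
  case 0
  then show ?case by (auto simp: lookup_single when_def)
next
  case (Suc n)
  have vanish: "Poly_Mapping.lookup (vf_comp A n (Poly_Mapping.single (\<beta> + m - axis i 1) 1)) \<alpha> = 0"
    if "\<beta> $ i \<noteq> 0" for i m
    using mdeg_shift_ge[OF that, of m] Suc.prems by (intro Suc.IH) simp
  show ?case
    unfolding lookup_vf_comp_Suc
  proof (intro sum.neutral ballI)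
    fix i
    show "of_nat (\<beta> $ i) * (\<Sum>m\<in>Poly_Mapping.keys (A (Suc n) i).
        Poly_Mapping.lookup (A (Suc n) i) m *
        Poly_Mapping.lookup (vf_comp A n (Poly_Mapping.single (\<beta> + m - axis i 1) 1)) \<alpha>) = 0"
      by (cases "\<beta> $ i = 0") (simp_all add: vanish del: One_nat_def)
  qed
qed

lemma sum_norm_le_vf_norm:
  "(\<Sum>m\<in>Poly_Mapping.keys (A i). norm (Poly_Mapping.lookup (A i) m)) \<le> vf_norm A"
  unfolding vf_norm_def by (rule cSUP_upper) auto

lemma vf_norm_nonneg: "vf_norm A \<ge> 0"
  using sum_norm_le_vf_norm[of A] by (meson order_trans norm_ge_zero sum_nonneg)

lemma norm_lookup_vf_comp_Suc_le:
  assumes "\<And>k. norm (Poly_Mapping.lookup (vf_comp A n (Poly_Mapping.single k 1)) \<alpha>) \<le> C"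
  shows "norm (Poly_Mapping.lookup (vf_comp A (Suc n) (Poly_Mapping.single \<beta> 1)) \<alpha>)
    \<le> C * vf_norm (A (Suc n)) * real (mdeg \<beta>)"
proof -
  let ?a = "\<lambda>i m. Poly_Mapping.lookup (A (Suc n) i) m"
  let ?e = "\<lambda>k. Poly_Mapping.lookup (vf_comp A n (Poly_Mapping.single k 1)) \<alpha>"
  have C: "0 \<le> C"
    using assms norm_ge_zero order_trans by blast
  have inner: "norm (\<Sum>m\<in>Poly_Mapping.keys (A (Suc n) i). ?a i m * ?e (\<beta> + m - axis i 1))
      \<le> C * vf_norm (A (Suc n))" for i
  proof -
    have "norm (\<Sum>m\<in>Poly_Mapping.keys (A (Suc n) i). ?a i m * ?e (\<beta> + m - axis i 1))
        \<le> (\<Sum>m\<in>Poly_Mapping.keys (A (Suc n) i). norm (?a i m) * C)"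
      by (rule sum_norm_le) (auto simp: norm_mult intro!: mult_left_mono assms)
    also have "\<dots> = C * (\<Sum>m\<in>Poly_Mapping.keys (A (Suc n) i). norm (?a i m))"
      by (simp add: sum_distrib_left mult.commute)
    also have "\<dots> \<le> C * vf_norm (A (Suc n))"
      by (intro mult_left_mono sum_norm_le_vf_norm C)
    finally show ?thesis .
  qed
  have "norm (Poly_Mapping.lookup (vf_comp A (Suc n) (Poly_Mapping.single \<beta> 1)) \<alpha>)
      \<le> (\<Sum>i\<in>UNIV. real (\<beta> $ i) * (C * vf_norm (A (Suc n))))"
    unfolding lookup_vf_comp_Suc
    by (rule sum_norm_le) (auto simp: norm_mult intro!: mult_left_mono inner simp del: One_nat_def)
  also have "\<dots> = C * vf_norm (A (Suc n)) * real (mdeg \<beta>)"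
    by (simp add: mdeg_def sum_distrib_left mult.commute)
  finally show ?thesis .
qed

text \<open>
  A bound uniform in \<open>\<beta>\<close>: a nonzero coefficient forces \<open>deg \<beta> \<le> deg \<alpha> + n\<close>, so the factor
  \<open>deg \<beta>\<close> of each step can be absorbed into the factorial before the next step.
\<close>

lemma norm_lookup_vf_comp_le:
  "norm (Poly_Mapping.lookup (vf_comp A n (Poly_Mapping.single \<beta> 1)) \<alpha>)
     \<le> fact (mdeg \<alpha> + n) / fact (mdeg \<alpha>) * (\<Prod>j=1..n. vf_norm (A j))"
proof (induction n arbitrary: \<beta>)
  case 0
  show ?case by (simp add: lookup_single when_def)
next
  case (Suc n)
  let ?C = "fact (mdeg \<alpha> + n) / fact (mdeg \<alpha>) * (\<Prod>j=1..n. vf_norm (A j))"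
  let ?C' = "fact (mdeg \<alpha> + Suc n) / fact (mdeg \<alpha>) * (\<Prod>j=1..Suc n. vf_norm (A j))"
  have nonneg: "0 \<le> ?C * vf_norm (A (Suc n))"
    by (intro mult_nonneg_nonneg prod_nonneg vf_norm_nonneg) (auto simp: vf_norm_nonneg)
  have C': "?C' = ?C * vf_norm (A (Suc n)) * real (mdeg \<alpha> + Suc n)"
    by (simp add: field_simps)
  show ?case
  proof (cases "mdeg \<beta> \<le> mdeg \<alpha> + Suc n")
    case True
    have "norm (Poly_Mapping.lookup (vf_comp A (Suc n) (Poly_Mapping.single \<beta> 1)) \<alpha>)
        \<le> ?C * vf_norm (A (Suc n)) * real (mdeg \<beta>)"
      by (rule norm_lookup_vf_comp_Suc_le) (rule Suc.IH)
    also have "\<dots> \<le> ?C * vf_norm (A (Suc n)) * real (mdeg \<alpha> + Suc n)"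
      using True by (intro mult_left_mono nonneg) simp
    finally show ?thesis unfolding C' .
  next
    case False
    then have "norm (Poly_Mapping.lookup (vf_comp A (Suc n) (Poly_Mapping.single \<beta> 1)) \<alpha>) = 0"
      using lookup_vf_comp_eq_0[of \<alpha> "Suc n" \<beta> A] by simp
    also have "\<dots> \<le> ?C'"
      unfolding C' by (intro mult_nonneg_nonneg nonneg) simp
    finally show ?thesis .
  qed
qed

theorem mainTheorem3:
  fixes A :: "nat \<Rightarrow> 'p::finite vector_field" and n :: nat and \<alpha> \<beta> :: "nat ^ 'p"
  assumes "n \<ge> 1"
  shows
    "has_iterated_sum (n - 1)
       (\<lambda>ks. \<Prod>j=1..n. counit (derivation_of (A j)
                 (fgen ((\<alpha> # ks @ [\<beta>]) ! j) ((\<alpha> # ks @ [\<beta>]) ! (j - 1)))))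
       (counit (comp_derivations A n (fgen \<beta> \<alpha>)))
     \<and> norm (counit (comp_derivations A n (fgen \<beta> \<alpha>)))
         \<le> fact (mdeg \<alpha> + n) / fact (mdeg \<alpha>) * (\<Prod>j=1..n. vf_norm (A j)) * real (mdeg \<beta>)
     \<and> (mdeg \<beta> > mdeg \<alpha> + n + 1 \<longrightarrow> counit (comp_derivations A n (fgen \<beta> \<alpha>)) = 0)"
proof -
  obtain r where n: "n = Suc r"
    using assms by (cases n) auto
  let ?P = "(\<Prod>j=1..r. vf_norm (A j)) * vf_norm (A (Suc r))"
  have P: "0 \<le> ?P"
    by (intro mult_nonneg_nonneg prod_nonneg) (auto simp: vf_norm_nonneg)
  have "norm (Poly_Mapping.lookup (vf_comp A n (Poly_Mapping.single \<beta> 1)) \<alpha>)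
      \<le> fact (mdeg \<alpha> + r) / fact (mdeg \<alpha>) * (\<Prod>j=1..r. vf_norm (A j)) * vf_norm (A (Suc r))
        * real (mdeg \<beta>)"
    unfolding n by (rule norm_lookup_vf_comp_Suc_le) (rule norm_lookup_vf_comp_le)
  also have "\<dots> = fact (mdeg \<alpha> + r) / fact (mdeg \<alpha>) * (?P * real (mdeg \<beta>))"
    by (simp only: mult.assoc)
  also have "\<dots> \<le> fact (mdeg \<alpha> + n) / fact (mdeg \<alpha>) * (?P * real (mdeg \<beta>))"
    using mult_nonneg_nonneg[OF P, of "real (mdeg \<beta>)"] unfolding n
    by (intro mult_right_mono divide_right_mono fact_mono) auto
  also have "\<dots> = fact (mdeg \<alpha> + n) / fact (mdeg \<alpha>) * (\<Prod>j=1..n. vf_norm (A j)) * real (mdeg \<beta>)"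
    unfolding n by (simp add: mult.assoc)
  finally show ?thesis
    using has_iterated_sum_paths[of r A \<alpha> \<beta>] lookup_vf_comp_eq_0[of \<alpha> n \<beta> A]
    unfolding counit_derivation_of counit_comp_derivations n by simp
qed

end
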